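(* Let $n\ge 2$ and let $\mathbb{A}=(a_{i_1i_2\ldots i_m})$ be a nonnegative weakly irreducible tensor of order $m\ge 2$ and dimension $n$ with $a_{ii\ldots i}=0$ for all $i\in[n]$. Let $R_i>0$ for each $i\in[n]$ and put $S_i=\sum_{i_2,\ldots,i_m=1}^n a_{ii_2\ldots i_m}R_{i_2}\cdots R_{i_m}$. Let $t_i\ge 0$ for $i\in[n]$, and let $\mathbb{B}=\mathbb{A}+\mathbb{M}$, where $\mathbb{M}$ is the diagonal tensor of order $m$ and dimension $n$ whose entry in position $(i,i,\ldots,i)$ is $t_i$ and whose other entries are $0$. For $1\le i,j\le n$ write $$F(i,j)=\frac{t_i+t_j+\sqrt{(t_i-t_j)^2+\frac{4S_iS_j}{(R_iR_j)^{m-1}}}}{2}.$$ Then $$\min_{1\le i,j\le n}\{F(i,j): j\in N(i)\}\le \rho(\mathbb{B})\le \max_{1\le i,j\le n}\{F(i,j): j\in N(i)\}.$$ Moreover, one of these two equalities holds if and only if one of the following two conditions holds: (i) $t_i+\frac{S_i}{R_i^{m-1}}=t_j+\frac{S_j}{R_j^{m-1}}$ for all $i,j\in[n]$; (ii) there exist subsets $U$ and $W$ of $[n]$ such that (1) $[n]=U\cup W$ with $U\cap W=\emptyset$; (2) $a_{i_1i_2\ldots i_m}\ne0$ only when $i_1\in U$ and $i_2,\ldots,i_m\in W$, or $i_1\in W$ and $i_2,\ldots,i_m\in U$; (3) there exists $\ell>0$ such that $\rho(\mathbb{B})=t_i+\frac{\ell^{m-1}S_i}{R_i^{m-1}}=t_j+\frac{S_j}{\ell^{m-1}R_j^{m-1}}$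 for all $i\in U$ and all $j\in W$. In fact, $\ell>1$ when the left equality holds and $\ell<1$ when the right equality holds.
   Context: Write $[n]=\{1,\ldots,n\}$. For a tensor $\mathbb{A}$ of order $m$ and dimension $n$ and $X=(x_1,\ldots,x_n)^T\in\mathbb{C}^n$, $\mathbb{A}X$ is the vector with $(\mathbb{A}X)_i=\sum_{i_2,\ldots,i_m=1}^n a_{ii_2\ldots i_m}x_{i_2}\cdots x_{i_m}$. A number $\lambda\in\mathbb{C}$ is an eigenvalue of $\mathbb{A}$ if there is a nonzero $X\in\mathbb{C}^n$ with $\mathbb{A}X=\lambda X^{[m-1]}$, where $X^{[m-1]}=(x_1^{m-1},\ldots,x_n^{m-1})^T$. The spectral radius is $\rho(\mathbb{A})=\max\{|\lambda|:\lambda \text{ an eigenvalue of }\mathbb{A}\}$. For $i\in[n]$, $N(i)=N_{\mathbb{A}}(i)$ denotes the set of all $j\in[n]$ such that $j\in\{i_2,\ldots,i_m\}$ for some $(i_2,\ldots,i_m)$ with $a_{ii_2\ldots i_m}\ne0$. $\mathbb{A}$ is weakly reducible if there is a nonempty proper subset $I\subset[n]$ such that $a_{i_1i_2\ldots i_m}=0$ whenever $i_1\in I$ and at least one of $i_2,\ldots,i_m\notin I$; otherwise it is weakly irreducible.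
   Formalization: The last sentence is read as: if the left (right) equality holds, then (i) holds or (ii) holds for some choice of U, W and ℓ with ℓ>1 (ℓ<1); literally it fails, since (ii) forces both equalities and swapping U and W replaces ℓ by 1/ℓ. *)

theory Defs
  imports "HOL-Analysis.Analysis"
begin

text \<open>
  The dimension is the cardinality of a finite index type \<open>'n\<close>. The entry in position
  \<open>(i\<^sub>1, \<dots>, i\<^sub>m)\<close> of a tensor of order \<open>m\<close> is its value at the list \<open>[i\<^sub>1, \<dots>, i\<^sub>m]\<close>; the order is
  an explicit argument of every notion below, and values at lists of any other length are
  irrelevant.
\<close>

type_synonym ('a, 'n) tensor = "'n list \<Rightarrow> 'a"

definition tensor_apply ::
    "nat \<Rightarrow> ('a::comm_semiring_1, 'n::finite) tensor \<Rightarrow> 'a ^ 'n \<Rightarrow> 'a ^ 'n" where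
  "tensor_apply m A X =
     (\<chi> i. \<Sum>js | length js = m - 1. A (i # js) * prod_list (map (\<lambda>j. X $ j) js))"

definition tensor_eigenvalue :: "nat \<Rightarrow> (complex, 'n::finite) tensor \<Rightarrow> complex \<Rightarrow> bool" where
  "tensor_eigenvalue m A \<mu> \<longleftrightarrow>
     (\<exists>X :: complex ^ 'n. X \<noteq> 0 \<and> tensor_apply m A X = (\<chi> i. \<mu> * (X $ i) ^ (m - 1)))"

text \<open>
  \<open>Greatest\<close> is the maximum of the set of moduli; unlike \<open>Max\<close> it does not presuppose that the
  set of eigenvalues is finite.
\<close>

definition tensor_spectral_radius :: "nat \<Rightarrow> (complex, 'n::finite) tensor \<Rightarrow> real" where
  "tensor_spectral_radius m A = (GREATEST r. \<exists>\<mu>. tensor_eigenvalue m A \<mu> \<and> r = cmod \<mu>)"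

definition tensor_nbrs :: "nat \<Rightarrow> ('a::zero, 'n) tensor \<Rightarrow> 'n \<Rightarrow> 'n set" where
  "tensor_nbrs m A i = {j. \<exists>js. length js = m - 1 \<and> A (i # js) \<noteq> 0 \<and> j \<in> set js}"

definition nonneg_tensor :: "nat \<Rightarrow> (real, 'n) tensor \<Rightarrow> bool" where
  "nonneg_tensor m A \<longleftrightarrow> (\<forall>js. length js = m \<longrightarrow> 0 \<le> A js)"

definition weakly_reducible :: "nat \<Rightarrow> ('a::zero, 'n) tensor \<Rightarrow> bool" where
  "weakly_reducible m A \<longleftrightarrow>
     (\<exists>I. I \<noteq> {} \<and> I \<noteq> UNIV \<and>
        (\<forall>i js. i \<in> I \<and> length js = m - 1 \<and> (\<exists>j\<in>set js. j \<notin> I) \<longrightarrow> A (i # js) = 0))"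

definition weakly_irreducible :: "nat \<Rightarrow> ('a::zero, 'n) tensor \<Rightarrow> bool" where
  "weakly_irreducible m A \<longleftrightarrow> \<not> weakly_reducible m A"

definition diag_tensor :: "nat \<Rightarrow> 'a::zero ^ 'n \<Rightarrow> ('a, 'n::finite) tensor" where
  "diag_tensor m t js = (if js = replicate m (hd js) then t $ hd js else 0)"

definition tensor_bipartition :: "nat \<Rightarrow> ('a::zero, 'n) tensor \<Rightarrow> 'n set \<Rightarrow> 'n set \<Rightarrow> bool" where
  "tensor_bipartition m A U W \<longleftrightarrow>
     UNIV = U \<union> W \<and> U \<inter> W = {} \<and>
     (\<forall>i js. length js = m - 1 \<and> A (i # js) \<noteq> 0 \<longrightarrow>
        (i \<in> U \<and> set js \<subseteq> W) \<or> (i \<in> W \<and> set js \<subseteq> U))"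

end

theory Submission
  imports Defs
begin

text \<open>
  Minimising the largest Collatz-Wielandt quotient over positive vectors produces a positive
  eigenvector \<open>x\<close> of \<open>B\<close>, and comparing any eigenvector with it shows that its eigenvalue is \<open>\<rho>\<close>.
  Put \<open>Y\<^sub>i = (x\<^sub>i / R\<^sub>i) ^ (m - 1)\<close>, \<open>s\<^sub>i = S\<^sub>i / R\<^sub>i ^ (m - 1)\<close> and \<open>u\<^sub>i = (\<rho> - t\<^sub>i) / s\<^sub>i\<close>. The eigenvalue equation
  says that \<open>u\<^sub>i Y\<^sub>i\<close> is a weighted mean of products of \<open>x\<^sub>j / R\<^sub>j\<close> over neighbours \<open>j\<close> of \<open>i\<close>, so it lies
  between the extreme values of \<open>Y\<close> on \<open>N(i)\<close>; and \<open>F(i,j)\<close> is the larger root of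
  \<open>(z - t\<^sub>i) (z - t\<^sub>j) = s\<^sub>i s\<^sub>j\<close>, so \<open>F(i,j) \<le> \<rho>\<close> iff \<open>u\<^sub>i u\<^sub>j \<ge> 1\<close>. Evaluating the mean property at a
  maximiser \<open>p\<close> of \<open>Y\<close> and at a maximiser \<open>q\<close> of \<open>Y\<close> on \<open>N(p)\<close> gives \<open>u\<^sub>p u\<^sub>q \<le> 1\<close>. In the equality
  case \<open>Y\<close> alternates between two values along every walk from \<open>p\<close>, and the two level sets are
  \<open>U\<close> and \<open>W\<close>.
\<close>

section \<open>Products over lists of indices\<close>

lemma finite_lists_length: "finite {js :: 'n::finite list. length js = k}"
  using finite_lists_length_eq[of "UNIV :: 'n set" k] by simp

lemma prod_list_pos:
  fixes f :: "'a \<Rightarrow> real"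
  assumes "\<And>j. j \<in> set js \<Longrightarrow> 0 < f j"
  shows "0 < prod_list (map f js)"
  using assms by (induction js) auto

lemma prod_list_mono_real:
  fixes f g :: "'a \<Rightarrow> real"
  assumes "\<And>j. j \<in> set js \<Longrightarrow> 0 < f j \<and> f j \<le> g j"
  shows "prod_list (map f js) \<le> prod_list (map g js)"
  using assms
proof (induction js)
  case (Cons a js)
  have "0 < prod_list (map f js)" by (rule prod_list_pos) (use Cons.prems in auto)
  moreover have "prod_list (map f js) \<le> prod_list (map g js)" using Cons by auto
  moreover have "0 < f a" "f a \<le> g a" using Cons.prems by auto
  ultimately show ?case by (simp add: mult_mono)
qed simp

text \<open>A strict inequality between two factors would survive multiplication by the remaining
  positive product, so the heads agree and cancel. This is the source of rigidity in the equality
  case.\<close>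

lemma prod_list_eq_imp_eq:
  fixes f g :: "'a \<Rightarrow> real"
  assumes "\<And>j. j \<in> set js \<Longrightarrow> 0 < f j \<and> f j \<le> g j"
    and "prod_list (map f js) = prod_list (map g js)"
    and "j \<in> set js"
  shows "f j = g j"
  using assms
proof (induction js)
  case (Cons a js)
  have F: "0 < prod_list (map f js)" by (rule prod_list_pos) (use Cons.prems in auto)
  have FG: "prod_list (map f js) \<le> prod_list (map g js)"
    by (rule prod_list_mono_real) (use Cons.prems in auto)
  have a: "0 < f a" "f a \<le> g a" using Cons.prems by auto
  have eq: "f a * prod_list (map f js) = g a * prod_list (map g js)"
    using Cons.prems by simp
  have "f a = g a"
  proof (rule ccontr)
    assume "f a \<noteq> g a"
    then have "f a * prod_list (map f js) < g a * prod_list (map f js)" using a F by simp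
    also have "\<dots> \<le> g a * prod_list (map g js)" using a FG by (intro mult_left_mono) auto
    finally show False using eq by simp
  qed
  moreover have "prod_list (map f js) = prod_list (map g js)"
    using eq \<open>f a = g a\<close> a by simp
  ultimately show ?case using Cons by auto
qed simp

lemma prod_list_map_scale:
  fixes f :: "'a \<Rightarrow> 'b::comm_semiring_1"
  shows "prod_list (map (\<lambda>j. c * f j) js) = c ^ length js * prod_list (map f js)"
  by (induction js) (simp_all add: algebra_simps)

lemma norm_prod_list:
  fixes f :: "'a \<Rightarrow> complex"
  shows "cmod (prod_list (map f js)) = prod_list (map (\<lambda>j. cmod (f j)) js)"
  by (induction js) (simp_all add: norm_mult)

lemma of_real_prod_list:
  "complex_of_real (prod_list (map f js)) = prod_list (map (\<lambda>j. complex_of_real (f j)) js)"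
  by (induction js) simp_all

lemma continuous_on_prod_list:
  fixes f :: "'b::topological_space \<Rightarrow> 'a \<Rightarrow> real"
  assumes "\<And>j. continuous_on T (\<lambda>x. f x j)"
  shows "continuous_on T (\<lambda>x. prod_list (map (f x) js))"
  by (induction js) (auto intro!: continuous_intros assms)

lemma map_vec_nth_lambda: "map (($) (\<chi> j. f j)) js = map f js"
  by simp

section \<open>The action of a tensor on a vector and its monotonicity\<close>

lemma tensor_apply_nth:
  "tensor_apply m A x $ i = (\<Sum>js | length js = m - 1. A (i # js) * prod_list (map (\<lambda>j. x $ j) js))"
  by (simp add: tensor_apply_def)

lemma tensor_apply_scale:
  "tensor_apply m A (\<chi> j. c * x $ j) $ i = c ^ (m - 1) * tensor_apply m A x $ i"
  unfolding tensor_apply_nth sum_distrib_left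
  by (rule sum.cong) (auto simp: map_vec_nth_lambda prod_list_map_scale algebra_simps)

lemma continuous_on_tensor_apply:
  fixes A :: "(real, 'n::finite) tensor"
  assumes "continuous_on T g"
  shows "continuous_on T (\<lambda>x. tensor_apply m A (g x) $ i)"
  unfolding tensor_apply_nth
  by (intro continuous_intros continuous_on_prod_list assms)

text \<open>In row \<open>i\<close> the diagonal tensor can be nonzero only at the constant list
  \<open>replicate (m - 1) i\<close>, so its sum collapses to one term.\<close>

lemma tensor_apply_add_diag:
  fixes A :: "('a::comm_semiring_1, 'n::finite) tensor"
  assumes "m \<ge> 2"
  shows "tensor_apply m (\<lambda>js. A js + diag_tensor m t js) x $ i
    = tensor_apply m A x $ i + t $ i * (x $ i) ^ (m - 1)"
proof -
  have m: "m = Suc (m - 1)" using assms by simp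
  have d: "diag_tensor m t (i # js) = (if js = replicate (m - 1) i then t $ i else 0)" for js
    unfolding diag_tensor_def by (subst m) (simp del: One_nat_def)
  have "(\<Sum>js | length js = m - 1. diag_tensor m t (i # js) * prod_list (map (\<lambda>j. x $ j) js))
    = (\<Sum>js | length js = m - 1. if js = replicate (m - 1) i then t $ i * (x $ i) ^ (m - 1) else 0)"
    by (rule sum.cong) (auto simp: d)
  also have "\<dots> = t $ i * (x $ i) ^ (m - 1)"
    by (subst sum.delta) (auto simp: finite_lists_length)
  finally show ?thesis
    unfolding tensor_apply_nth by (simp add: distrib_right sum.distrib)
qed

lemma nonneg_tensor_Cons:
  "nonneg_tensor m A \<Longrightarrow> m \<ge> 2 \<Longrightarrow> length js = m - 1 \<Longrightarrow> 0 \<le> A (i # js)"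
  by (simp add: nonneg_tensor_def)

text \<open>A list with nonzero coefficient in row \<open>i\<close> consists of neighbours of
  \<open>i\<close>, so the summands compare one by one. If the sums agree then so do all summands,
  and a nonzero coefficient passes the equality on to every factor.\<close>

lemma tensor_apply_mono:
  fixes A :: "(real, 'n::finite) tensor"
  assumes A: "nonneg_tensor m A" "m \<ge> 2"
    and x: "\<And>j. j \<in> tensor_nbrs m A i \<Longrightarrow> 0 < x $ j \<and> x $ j \<le> y $ j"
  shows "tensor_apply m A x $ i \<le> tensor_apply m A y $ i"
    and "tensor_apply m A x $ i = tensor_apply m A y $ i \<Longrightarrow> j \<in> tensor_nbrs m A i
      \<Longrightarrow> x $ j = y $ j"
proof -
  have le: "A (i # js) * prod_list (map (\<lambda>j. x $ j) js) \<le> A (i # js) * prod_list (map (\<lambda>j. y $ j) js)"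
    if "length js = m - 1" for js
  proof (cases "A (i # js) = 0")
    case False
    then have "prod_list (map (\<lambda>j. x $ j) js) \<le> prod_list (map (\<lambda>j. y $ j) js)"
      using that x by (intro prod_list_mono_real) (auto simp: tensor_nbrs_def)
    then show ?thesis using nonneg_tensor_Cons[OF A that] by (simp add: mult_left_mono)
  qed simp
  show "tensor_apply m A x $ i \<le> tensor_apply m A y $ i"
    unfolding tensor_apply_nth by (rule sum_mono) (use le in auto)
  assume eq: "tensor_apply m A x $ i = tensor_apply m A y $ i" and "j \<in> tensor_nbrs m A i"
  then obtain js where js: "length js = m - 1" "A (i # js) \<noteq> 0" "j \<in> set js"
    by (auto simp: tensor_nbrs_def)
  have "A (i # js) * prod_list (map (\<lambda>j. x $ j) js) = A (i # js) * prod_list (map (\<lambda>j. y $ j) js)"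
    by (rule sum_mono_inv[OF eq[unfolded tensor_apply_nth]])
      (use le js in \<open>auto simp: finite_lists_length\<close>)
  then have "prod_list (map (\<lambda>j. x $ j) js) = prod_list (map (\<lambda>j. y $ j) js)"
    using js by simp
  then show "x $ j = y $ j"
    using js x by (intro prod_list_eq_imp_eq[of js "\<lambda>j. x $ j" "\<lambda>j. y $ j"]) (auto simp: tensor_nbrs_def)
qed

section \<open>Weak irreducibility through sets closed under neighbours\<close>

text \<open>A proper nonempty closed set would itself witness weak reducibility. The lemma serves as
  an induction principle: whatever spreads to neighbours holds everywhere.\<close>

lemma weakly_irreducible_closed:
  assumes "weakly_irreducible m A" "V \<noteq> {}" "\<And>i. i \<in> V \<Longrightarrow> tensor_nbrs m A i \<subseteq> V"
  shows "V = UNIV"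
proof (rule ccontr)
  assume "V \<noteq> UNIV"
  moreover have "\<forall>i js. i \<in> V \<and> length js = m - 1 \<and> (\<exists>j\<in>set js. j \<notin> V) \<longrightarrow> A (i # js) = 0"
    using assms(3) by (fastforce simp: tensor_nbrs_def)
  ultimately show False
    using assms(1,2) unfolding weakly_irreducible_def weakly_reducible_def by blast
qed

lemma weakly_irreducible_nbrs_nonempty:
  fixes A :: "('a::zero, 'n::finite) tensor"
  assumes "weakly_irreducible m A" "CARD('n) \<ge> 2"
  shows "tensor_nbrs m A i \<noteq> {}"
proof
  assume "tensor_nbrs m A i = {}"
  then have "{i} = UNIV" by (intro weakly_irreducible_closed[OF assms(1)]) auto
  then have "CARD('n) = 1" by (metis card_1_singleton_iff One_nat_def)
  then show False using assms(2) by simp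
qed

lemma tensor_apply_pos:
  fixes A :: "(real, 'n::finite) tensor"
  assumes A: "nonneg_tensor m A" "m \<ge> 2" and "tensor_nbrs m A i \<noteq> {}" and x: "\<And>j. 0 < x $ j"
  shows "0 < tensor_apply m A x $ i"
proof -
  obtain js where "length js = m - 1" "A (i # js) \<noteq> 0"
    using assms(3) by (auto simp: tensor_nbrs_def)
  then show ?thesis
    unfolding tensor_apply_nth using nonneg_tensor_Cons[OF A] x prod_list_pos[of _ "\<lambda>j. x $ j"]
    by (intro sum_pos2[of _ js])
      (auto simp: finite_lists_length less_eq_real_def intro!: mult_pos_pos mult_nonneg_nonneg)
qed

section \<open>The spectral radius from a positive eigenvector\<close>

text \<open>The multiple \<open>c * x\<close> is chosen to dominate the moduli of an arbitrary
  eigenvector \<open>X\<close> and to touch them at an index \<open>p\<close>. Taking moduli in row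
  \<open>p\<close> of the equation for \<open>X\<close> bounds its eigenvalue by
  \<open>r\<close>.\<close>

lemma tensor_spectral_radius_eq:
  fixes B :: "(real, 'n::finite) tensor"
  assumes B: "nonneg_tensor m B" "m \<ge> 2"
    and x: "\<And>i. 0 < x $ i" and ev: "\<And>i. tensor_apply m B x $ i = r * (x $ i) ^ (m - 1)"
    and r: "0 \<le> r"
  shows "tensor_spectral_radius m (\<lambda>js. complex_of_real (B js)) = r"
  unfolding tensor_spectral_radius_def
proof (rule Greatest_equality)
  let ?X = "(\<chi> i. complex_of_real (x $ i))"
  have "tensor_apply m (\<lambda>js. complex_of_real (B js)) ?X $ i = complex_of_real (tensor_apply m B x $ i)" for i
    unfolding tensor_apply_nth by (simp add: map_vec_nth_lambda of_real_prod_list)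
  then have "tensor_apply m (\<lambda>js. complex_of_real (B js)) ?X = (\<chi> i. complex_of_real r * (?X $ i) ^ (m - 1))"
    by (simp add: vec_eq_iff ev)
  moreover have "?X \<noteq> 0" using x by (simp add: vec_eq_iff) (metis less_irrefl)
  ultimately have "tensor_eigenvalue m (\<lambda>js. complex_of_real (B js)) (complex_of_real r)"
    unfolding tensor_eigenvalue_def by blast
  then show "\<exists>\<mu>. tensor_eigenvalue m (\<lambda>js. complex_of_real (B js)) \<mu> \<and> r = cmod \<mu>"
    using r by (intro exI[of _ "complex_of_real r"]) simp
next
  fix s assume "\<exists>\<mu>. tensor_eigenvalue m (\<lambda>js. complex_of_real (B js)) \<mu> \<and> s = cmod \<mu>"
  then obtain \<mu> X where s: "s = cmod \<mu>" and X0: "X \<noteq> 0"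
    and X: "tensor_apply m (\<lambda>js. complex_of_real (B js)) X = (\<chi> i. \<mu> * (X $ i) ^ (m - 1))"
    unfolding tensor_eigenvalue_def by blast
  let ?q = "\<lambda>i. cmod (X $ i) / x $ i"
  define c where "c = Max (range ?q)"
  have le: "cmod (X $ i) \<le> c * x $ i" for i
  proof -
    have "?q i \<le> c" unfolding c_def by (rule Max_ge) auto
    then show ?thesis using x[of i] by (simp add: field_simps)
  qed
  have "c \<in> range ?q" unfolding c_def by (rule Max_in) auto
  then obtain p where p: "c = ?q p" by blast
  \<comment> \<open>A nonzero coordinate makes \<open>c\<close> positive, so that the power of
    \<open>c * x $ p\<close> can be cancelled at the end.\<close>
  obtain i0 where "X $ i0 \<noteq> 0" using X0 by (auto simp: vec_eq_iff)
  then have "0 < c * x $ i0" using le[of i0] by (meson less_le_trans zero_less_norm_iff)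
  then have c: "0 < c" using x[of i0] by (simp add: zero_less_mult_iff)
  have Xp: "cmod (X $ p) = c * x $ p" using p x[of p] by simp
  have "s * (c * x $ p) ^ (m - 1) = cmod (tensor_apply m (\<lambda>js. complex_of_real (B js)) X $ p)"
    by (simp add: X s norm_mult norm_power Xp)
  also have "\<dots> \<le> (\<Sum>js | length js = m - 1. cmod (complex_of_real (B (p # js)) * prod_list (map (\<lambda>j. X $ j) js)))"
    unfolding tensor_apply_nth by (rule norm_sum)
  also have "\<dots> \<le> (\<Sum>js | length js = m - 1. B (p # js) * prod_list (map (\<lambda>j. c * x $ j) js))"
  proof (rule sum_mono)
    fix js assume "js \<in> {js :: 'n list. length js = m - 1}"
    then have "0 \<le> B (p # js)" using nonneg_tensor_Cons[OF B] by auto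
    moreover have "prod_list (map (\<lambda>j. cmod (X $ j)) js) \<le> prod_list (map (\<lambda>j. c * x $ j) js)"
    proof (induction js)
      case (Cons a js)
      have "0 \<le> prod_list (map (\<lambda>j. cmod (X $ j)) js)" by (induction js) auto
      then show ?case using Cons le[of a] c x[of a] by (auto intro!: mult_mono)
    qed simp
    ultimately show "cmod (complex_of_real (B (p # js)) * prod_list (map (\<lambda>j. X $ j) js))
      \<le> B (p # js) * prod_list (map (\<lambda>j. c * x $ j) js)"
      by (simp add: norm_mult norm_prod_list mult_left_mono)
  qed
  also have "\<dots> = tensor_apply m B (\<chi> j. c * x $ j) $ p"
    unfolding tensor_apply_nth by (simp add: map_vec_nth_lambda)
  also have "\<dots> = r * (c * x $ p) ^ (m - 1)"
    by (simp add: tensor_apply_scale ev power_mult_distrib)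
  finally show "s \<le> r" using c x[of p] by simp
qed

section \<open>The quadratic equation for \<open>F\<close> and an extremal principle on a directed
  graph\<close>

text \<open>Since \<open>2 * r - a - b\<close> is nonnegative, it is the square root of
  \<open>(a - b)\<^sup>2 + 4 * ((r - a) * (r - b))\<close>; comparing radicands settles both
  equivalences.\<close>

lemma quadratic_root_le_iff:
  fixes a b c r :: real
  assumes "0 \<le> c" "a \<le> r" "b \<le> r"
  shows "(a + b + sqrt ((a - b)\<^sup>2 + 4 * c)) / 2 \<le> r \<longleftrightarrow> c \<le> (r - a) * (r - b)"
    and "r \<le> (a + b + sqrt ((a - b)\<^sup>2 + 4 * c)) / 2 \<longleftrightarrow> (r - a) * (r - b) \<le> c"
proof -
  have q: "(2 * r - a - b)\<^sup>2 = (a - b)\<^sup>2 + 4 * ((r - a) * (r - b))"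
    by (simp add: power2_eq_square algebra_simps)
  have s: "2 * r - a - b = sqrt ((2 * r - a - b)\<^sup>2)" using assms by simp
  have "(a + b + sqrt ((a - b)\<^sup>2 + 4 * c)) / 2 \<le> r \<longleftrightarrow> sqrt ((a - b)\<^sup>2 + 4 * c) \<le> 2 * r - a - b"
    by auto
  also have "\<dots> \<longleftrightarrow> c \<le> (r - a) * (r - b)" by (subst s) (simp only: real_sqrt_le_iff q, simp)
  finally show "(a + b + sqrt ((a - b)\<^sup>2 + 4 * c)) / 2 \<le> r \<longleftrightarrow> c \<le> (r - a) * (r - b)" .
  have "r \<le> (a + b + sqrt ((a - b)\<^sup>2 + 4 * c)) / 2 \<longleftrightarrow> 2 * r - a - b \<le> sqrt ((a - b)\<^sup>2 + 4 * c)"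
    by auto
  also have "\<dots> \<longleftrightarrow> (r - a) * (r - b) \<le> c" by (subst s) (simp only: real_sqrt_le_iff q, simp)
  finally show "r \<le> (a + b + sqrt ((a - b)\<^sup>2 + 4 * c)) / 2 \<longleftrightarrow> (r - a) * (r - b) \<le> c" .
qed

text \<open>The tensor enters only through its neighbour sets and the mean property, so that the
  same statement applies to \<open>u\<close>, \<open>Y\<close> for the upper bound and to their
  reciprocals for the lower one.\<close>

lemma extremal_weights:
  fixes N :: "'n::finite \<Rightarrow> 'n set" and u Y :: "'n \<Rightarrow> real"
  assumes u: "\<And>i. 0 < u i" and Y: "\<And>i. 0 < Y i" and N: "\<And>i. N i \<noteq> {}"
    and closed: "\<forall>V. V \<noteq> {} \<and> (\<forall>i\<in>V. N i \<subseteq> V) \<longrightarrow> V = UNIV"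
    and mean_le: "\<forall>i p. (\<forall>j\<in>N i. Y j \<le> Y p) \<longrightarrow>
      u i * Y i \<le> Y p \<and> (u i * Y i = Y p \<longrightarrow> (\<forall>j\<in>N i. Y j = Y p))"
  shows "\<exists>p q. q \<in> N p \<and> u p * u q \<le> 1"
    and "\<forall>i. \<forall>j\<in>N i. 1 \<le> u i * u j \<Longrightarrow>
      (\<forall>i. u i = 1) \<or>
      (\<exists>U W c. U \<union> W = UNIV \<and> U \<inter> W = {} \<and> 0 < c \<and> c < 1 \<and>
         (\<forall>i\<in>U. u i = c \<and> N i \<subseteq> W) \<and> (\<forall>i\<in>W. u i = 1 / c \<and> N i \<subseteq> U))"
proof -
  have mean: "u i * Y i \<le> Y p" if "\<And>j. j \<in> N i \<Longrightarrow> Y j \<le> Y p" for i p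
    using mean_le that by blast
  have mean_eq: "Y j = Y p" if "\<And>j. j \<in> N i \<Longrightarrow> Y j \<le> Y p" "u i * Y i = Y p" "j \<in> N i" for i p j
    using mean_le that by blast
  define \<alpha> where "\<alpha> = Max (range Y)"
  define b where "b i = Max (Y ` N i)" for i
  have Y_le: "Y i \<le> \<alpha>" for i unfolding \<alpha>_def by simp
  have \<alpha>: "0 < \<alpha>" using Y Y_le less_le_trans by blast
  have b_ge: "Y j \<le> b i" if "j \<in> N i" for i j unfolding b_def using that by simp
  have b_in: "\<exists>q\<in>N i. Y q = b i" for i
  proof -
    have "b i \<in> Y ` N i" unfolding b_def using N[of i] by (intro Max_in) auto
    then show ?thesis by auto
  qed
  have "\<alpha> \<in> range Y" unfolding \<alpha>_def by (rule Max_in) auto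
  then obtain p0 where p0: "Y p0 = \<alpha>" by blast
  \<comment> \<open>Among the maximisers of \<open>Y\<close>, one whose largest neighbour is largest; this choice prevents the
    neighbour value from growing along a walk.\<close>
  define \<beta> where "\<beta> = Max (b ` {i. Y i = \<alpha>})"
  have b_le: "b i \<le> \<beta>" if "Y i = \<alpha>" for i unfolding \<beta>_def using that by simp
  obtain p where p: "Y p = \<alpha>" "b p = \<beta>"
  proof -
    have "\<beta> \<in> b ` {i. Y i = \<alpha>}" unfolding \<beta>_def using p0 by (intro Max_in) auto
    then show thesis using that by auto
  qed
  have mean_b: "u i * \<alpha> \<le> b i" "0 < b i" if "Y i = \<alpha>" for i
  proof -
    obtain q where "q \<in> N i" "Y q = b i" using b_in by blast
    then show "u i * \<alpha> \<le> b i" "0 < b i" using mean[of i q] b_ge[of _ i] that Y[of q] by auto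
  qed
  have mean_\<alpha>: "u j * Y j \<le> \<alpha>" for j using mean[of j p0] Y_le p0 by auto
  \<comment> \<open>Multiply \<open>u i * \<alpha> \<le> b i\<close> by
    \<open>u q * b i \<le> \<alpha>\<close> and cancel \<open>\<alpha> * b i\<close>.\<close>
  have prod_le: "u i * u q \<le> 1" if "Y i = \<alpha>" "Y q = b i" for i q
  proof -
    have "(u i * \<alpha>) * (u q * Y q) \<le> b i * \<alpha>"
      using mean_b[OF that(1)] mean_\<alpha>[of q] u[of q] Y[of q] by (intro mult_mono) auto
    then have "(u i * u q) * (\<alpha> * b i) \<le> 1 * (\<alpha> * b i)" using that by (simp add: algebra_simps)
    then show ?thesis using \<alpha> mean_b(2)[OF that(1)] by (simp only: mult_le_cancel_right_pos mult_pos_pos)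
  qed
  obtain q where "q \<in> N p" "Y q = b p" using b_in by blast
  then show "\<exists>p q. q \<in> N p \<and> u p * u q \<le> 1" using prod_le[OF p(1)] by blast
  assume "\<forall>i. \<forall>j\<in>N i. 1 \<le> u i * u j"
  then have ge: "1 \<le> u i * u j" if "j \<in> N i" for i j using that by blast
  \<comment> \<open>With products at least 1, both inequalities behind \<open>prod_le\<close> become
    equalities. This is shown first for a neighbour \<open>q'\<close> attaining \<open>b i\<close>;
    equality in the mean then puts every neighbour of \<open>i\<close> at the value
    \<open>b i\<close>, so it extends to all of them.\<close>
  have tight: "u i * \<alpha> = b i" "Y q = b i" "u q * Y q = \<alpha>" "\<forall>k\<in>N q. Y k = \<alpha>"
    if i: "Y i = \<alpha>" and q: "q \<in> N i" for i q
  proof -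
    obtain q' where q': "q' \<in> N i" "Y q' = b i" using b_in by blast
    have main: "u i * \<alpha> = b i \<and> u k * b i = \<alpha>" if k: "k \<in> N i" "Y k = b i" for k
    proof -
      have 1: "u i * \<alpha> \<le> b i" "0 < b i" using mean_b[OF i] .
      have 2: "u k * b i \<le> \<alpha>" using mean_\<alpha>[of k] k by simp
      have "1 * (\<alpha> * b i) \<le> (u i * u k) * (\<alpha> * b i)"
        using ge[OF k(1)] \<alpha> 1 by (intro mult_right_mono) auto
      then have 3: "b i * \<alpha> \<le> (u i * \<alpha>) * (u k * b i)" by (simp add: algebra_simps)
      have "(u i * \<alpha>) * (u k * b i) \<le> (u i * \<alpha>) * \<alpha>"
        using 2 u[of i] \<alpha> by (intro mult_left_mono) auto
      then have "b i * \<alpha> \<le> (u i * \<alpha>) * \<alpha>" using 3 by linarith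
      then have e: "u i * \<alpha> = b i" using 1 \<alpha> by (simp add: mult_le_cancel_right_pos)
      have "b i * \<alpha> \<le> b i * (u k * b i)" using 3 e by simp
      then have "\<alpha> \<le> u k * b i" using 1 by (simp add: mult_le_cancel_left_pos)
      then show ?thesis using e 2 by simp
    qed
    show e: "u i * \<alpha> = b i" using main[OF q'] by simp
    show Yq: "Y q = b i" using mean_eq[of i q' q] b_ge[of _ i] q' q e i by auto
    show u: "u q * Y q = \<alpha>" using main[OF q Yq] Yq by simp
    show "\<forall>k\<in>N q. Y k = \<alpha>" using mean_eq[of q p0] Y_le p0 u by auto
  qed
  have \<beta>: "0 < \<beta>" using mean_b(2)[OF p(1)] p(2) by simp
  \<comment> \<open>The two kinds of index met on a walk from \<open>p\<close>; closure under
    neighbours makes them exhaust the index type.\<close>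
  define V where "V = {i. Y i = \<alpha> \<and> b i = \<beta>} \<union> {j. Y j = \<beta> \<and> u j * \<beta> = \<alpha> \<and> (\<forall>k\<in>N j. Y k = \<alpha>)}"
  have "V = UNIV"
  proof (rule closed[rule_format], intro conjI ballI)
    show "V \<noteq> {}" using p by (auto simp: V_def)
    fix i assume "i \<in> V"
    then consider "Y i = \<alpha>" "b i = \<beta>" | "Y i = \<beta>" "u i * \<beta> = \<alpha>" "\<forall>k\<in>N i. Y k = \<alpha>"
      by (auto simp: V_def)
    then show "N i \<subseteq> V"
    proof cases
      case 1
      then show ?thesis using tight(2-4)[OF 1(1)] by (auto simp: V_def)
    next
      case 2
      show ?thesis
      proof
        fix k assume k: "k \<in> N i"
        then have Yk: "Y k = \<alpha>" using 2 by simp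
        obtain q where "q \<in> N k" using N[of k] by blast
        then have uk: "u k * \<alpha> = b k" using tight(1)[OF Yk] by simp
        \<comment> \<open>The edge from \<open>i\<close> to \<open>k\<close> forces
          \<open>b k\<close> to be at least \<open>\<beta>\<close>, and the maximality of
          \<open>\<beta>\<close> gives the converse.\<close>
        have "1 * \<beta> \<le> (u i * u k) * \<beta>" using ge[OF k] \<beta> by (intro mult_right_mono) auto
        also have "\<dots> = (u i * \<beta>) * u k" by simp
        also have "\<dots> = b k" using 2(2) uk by (simp add: mult.commute)
        finally have "b k = \<beta>" using b_le[OF Yk] by simp
        then show "k \<in> V" using Yk by (simp add: V_def)
      qed
    qed
  qed
  then have cases: "(Y i = \<alpha> \<and> b i = \<beta>) \<or> (Y i = \<beta> \<and> u i * \<beta> = \<alpha> \<and> (\<forall>k\<in>N i. Y k = \<alpha>))" for i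
    by (auto simp: V_def)
  have u\<alpha>: "u i * \<alpha> = b i" "\<forall>j\<in>N i. Y j = b i" if "Y i = \<alpha>" for i
    using tight[OF that] N[of i] by blast+
  show "(\<forall>i. u i = 1) \<or>
      (\<exists>U W c. U \<union> W = UNIV \<and> U \<inter> W = {} \<and> 0 < c \<and> c < 1 \<and>
         (\<forall>i\<in>U. u i = c \<and> N i \<subseteq> W) \<and> (\<forall>i\<in>W. u i = 1 / c \<and> N i \<subseteq> U))"
  \<comment> \<open>If the two levels coincide, all weights are 1; otherwise the level sets are the
    two classes, with \<open>c = \<beta> / \<alpha>\<close>.\<close>
  proof (cases "\<alpha> = \<beta>")
    case True
    have "u i * \<alpha> = \<alpha>" for i
      using cases[of i] u\<alpha>(1)[of i] True by metis
    then have "u i = 1" for i using \<alpha> by (metis less_irrefl mult_cancel_right1)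
    then show ?thesis by simp
  next
    case False
    have "\<beta> \<le> \<alpha>" using b_in[of p] p(2) Y_le by metis
    then have lt: "\<beta> / \<alpha> < 1" using False \<alpha> by simp
    have "\<forall>i\<in>{i. Y i = \<alpha>}. u i = \<beta> / \<alpha> \<and> N i \<subseteq> {i. Y i = \<beta>}"
    proof (intro ballI conjI)
      fix i assume "i \<in> {i. Y i = \<alpha>}"
      then have "Y i = \<alpha>" "b i = \<beta>" using cases[of i] False by auto
      then show "u i = \<beta> / \<alpha>" "N i \<subseteq> {i. Y i = \<beta>}"
        using u\<alpha>[of i] \<alpha> by (auto simp: eq_divide_eq)
    qed
    moreover have "\<forall>i\<in>{i. Y i = \<beta>}. u i = 1 / (\<beta> / \<alpha>) \<and> N i \<subseteq> {i. Y i = \<alpha>}"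
    proof (intro ballI conjI)
      fix i assume "i \<in> {i. Y i = \<beta>}"
      then have "u i * \<beta> = \<alpha>" "\<forall>k\<in>N i. Y k = \<alpha>" using cases[of i] False by auto
      then show "u i = 1 / (\<beta> / \<alpha>)" "N i \<subseteq> {i. Y i = \<alpha>}"
        using \<beta> by (auto simp: eq_divide_eq)
    qed
    moreover have "{i. Y i = \<alpha>} \<union> {i. Y i = \<beta>} = UNIV" using cases by blast
    moreover have "{i. Y i = \<alpha>} \<inter> {i. Y i = \<beta>} = {}" using False by auto
    moreover have "0 < \<beta> / \<alpha>" using \<alpha> \<beta> by simp
    ultimately show ?thesis using lt by blast
  qed
qed

section \<open>Existence of a positive eigenvector\<close>

text \<open>The indices reachable from \<open>i\<close> form a nonempty set closed under
  neighbours.\<close>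

lemma rtrancl_nbrs:
  assumes "weakly_irreducible m A"
  shows "(i, j) \<in> {(i, j). j \<in> tensor_nbrs m A i}\<^sup>*"
proof -
  let ?E = "{(i, j). j \<in> tensor_nbrs m A i}"
  have "{j. (i, j) \<in> ?E\<^sup>*} = UNIV"
    by (rule weakly_irreducible_closed[OF assms]) (auto intro: rtrancl_into_rtrancl)
  then show ?thesis by blast
qed

text \<open>
  Weak irreducibility alone does not make every nonnegative eigenvector positive, but it bounds the
  ratios of the entries of a positive vector on which the Collatz-Wielandt quotients are bounded.
\<close>

lemma sublevel_bounded:
  fixes A :: "(real, 'n::finite) tensor"
  assumes A: "nonneg_tensor m A" "m \<ge> 2" "weakly_irreducible m A" and C: "0 \<le> C"
  obtains M where "\<And>x j. (\<And>i. 1 \<le> x $ i) \<Longrightarrow> (\<exists>i. x $ i = 1) \<Longrightarrow>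
    (\<And>i. tensor_apply m A x $ i \<le> C * (x $ i) ^ (m - 1)) \<Longrightarrow> x $ j \<le> M"
proof -
  define P :: "real ^ 'n \<Rightarrow> bool" where
    "P x \<longleftrightarrow> (\<forall>i. 1 \<le> x $ i) \<and> (\<forall>i. tensor_apply m A x $ i \<le> C * (x $ i) ^ (m - 1))" for x
  \<comment> \<open>Some term of row \<open>i\<close> contains \<open>x $ j\<close>, and its other
    factors are at least 1; that single term is already bounded by the whole row.\<close>
  have edge: "\<exists>K\<ge>0. \<forall>x. P x \<longrightarrow> x $ j \<le> K * (x $ i) ^ (m - 1)" if nbr: "j \<in> tensor_nbrs m A i" for i j
  proof -
    obtain js where js: "length js = m - 1" "A (i # js) \<noteq> 0" "j \<in> set js"
      using nbr by (auto simp: tensor_nbrs_def)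
    have a: "0 < A (i # js)" using nonneg_tensor_Cons[OF A(1,2) js(1), of i] js by simp
    have "x $ j \<le> C / A (i # js) * (x $ i) ^ (m - 1)" if x: "P x" for x
    proof -
      have x1: "1 \<le> x $ k" for k using x by (auto simp: P_def)
      have x0: "0 < x $ k" for k using x1[of k] by simp
      have ge1: "1 \<le> prod_list (map (\<lambda>j. x $ j) ks)" for ks
        using prod_list_mono_real[of ks "\<lambda>_. 1" "\<lambda>j. x $ j"] x1 by (simp add: map_replicate_const)
      obtain ks ls where "js = ks @ j # ls" using js(3) by (meson split_list)
      then have "prod_list (map (\<lambda>j. x $ j) js) = x $ j * (prod_list (map (\<lambda>j. x $ j) ks) * prod_list (map (\<lambda>j. x $ j) ls))"
        by simp
      moreover have "1 * 1 \<le> prod_list (map (\<lambda>j. x $ j) ks) * prod_list (map (\<lambda>j. x $ j) ls)"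
        using ge1 by (intro mult_mono) (auto intro: order_trans[OF _ ge1])
      ultimately have "x $ j \<le> prod_list (map (\<lambda>j. x $ j) js)"
        using x0[of j] by simp
      then have "A (i # js) * x $ j \<le> A (i # js) * prod_list (map (\<lambda>j. x $ j) js)"
        using a by simp
      also have "\<dots> \<le> tensor_apply m A x $ i"
        unfolding tensor_apply_nth
        by (rule member_le_sum)
          (use js nonneg_tensor_Cons[OF A(1,2)] x0 prod_list_pos[of _ "\<lambda>j. x $ j"] in
            \<open>auto simp: finite_lists_length less_eq_real_def[of 0 "prod_list _"] intro!: mult_nonneg_nonneg\<close>)
      also have "\<dots> \<le> C * (x $ i) ^ (m - 1)" using x by (simp add: P_def)
      finally show ?thesis using a by (simp add: field_simps)
    qed
    then show ?thesis using a C by (intro exI[of _ "C / A (i # js)"]) auto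
  qed
  \<comment> \<open>Edge bounds are composed along a path that starts at a coordinate equal to
    1.\<close>
  have path: "\<exists>M. \<forall>x. P x \<and> x $ i = 1 \<longrightarrow> x $ j \<le> M" for i j
    using rtrancl_nbrs[OF A(3), of i j]
  proof (induction rule: rtrancl_induct)
    case base
    show ?case by (intro exI[of _ 1]) auto
  next
    case (step k l)
    then obtain M where M: "\<And>x. P x \<Longrightarrow> x $ i = 1 \<Longrightarrow> x $ k \<le> M" by blast
    obtain K where K: "0 \<le> K" "\<And>x. P x \<Longrightarrow> x $ l \<le> K * (x $ k) ^ (m - 1)"
      using edge[of l k] step.hyps by auto
    have "x $ l \<le> K * M ^ (m - 1)" if x: "P x" "x $ i = 1" for x
    proof -
      have "0 \<le> x $ k" using x(1) by (auto simp: P_def intro: order_trans[of 0 1])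
      then have "K * (x $ k) ^ (m - 1) \<le> K * M ^ (m - 1)"
        using K(1) M[OF x] by (intro mult_left_mono power_mono) auto
      then show ?thesis using K(2)[OF x(1)] by linarith
    qed
    then show ?case by blast
  qed
  then obtain f where f: "\<And>i j x. P x \<Longrightarrow> x $ i = 1 \<Longrightarrow> x $ j \<le> f i j" by metis
  show thesis
  proof (rule that[of "Max (range (\<lambda>(i, j). f i j))"])
    fix x :: "real ^ 'n" and j
    assume x: "\<And>i. 1 \<le> x $ i" "\<And>i. tensor_apply m A x $ i \<le> C * (x $ i) ^ (m - 1)"
      and "\<exists>i. x $ i = 1"
    then obtain i where "x $ i = 1" by blast
    then have "x $ j \<le> f i j" using x by (intro f) (auto simp: P_def)
    also have "\<dots> \<le> Max (range (\<lambda>(i, j). f i j))" by (rule Max_ge) (auto intro: rev_image_eqI)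
    finally show "x $ j \<le> Max (range (\<lambda>(i, j). f i j))" .
  qed
qed

text \<open>Homogeneity allows the smallest coordinate to be normalised to 1;
  \<open>sublevel_bounded\<close> then confines all relevant competitors to a box, and the least
  bound is attained by compactness.\<close>

lemma minimal_superharmonic:
  fixes A :: "(real, 'n::finite) tensor" and t :: "real ^ 'n"
  assumes A: "nonneg_tensor m A" "m \<ge> 2" "weakly_irreducible m A" and t: "\<And>i. 0 \<le> t $ i"
  obtains x r where "\<And>i. 0 < x $ i"
    and "\<And>i. tensor_apply m A x $ i + t $ i * (x $ i) ^ (m - 1) \<le> r * (x $ i) ^ (m - 1)"
    and "\<And>y s. (\<And>i. 0 < y $ i) \<Longrightarrow>
      (\<And>i. tensor_apply m A y $ i + t $ i * (y $ i) ^ (m - 1) \<le> s * (y $ i) ^ (m - 1)) \<Longrightarrow> r \<le> s"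
proof -
  let ?Q = "\<lambda>x s i. tensor_apply m A x $ i + t $ i * (x $ i) ^ (m - 1) \<le> s * (x $ i) ^ (m - 1)"
  have nonneg: "0 \<le> tensor_apply m A x $ i" if "\<And>j. 0 < x $ j" for x i
    unfolding tensor_apply_nth
    using nonneg_tensor_Cons[OF A(1,2)] prod_list_pos[of _ "\<lambda>j. x $ j"] that
    by (intro sum_nonneg mult_nonneg_nonneg) (auto simp: less_imp_le)
  let ?one = "(\<chi> i. 1) :: real ^ 'n"
  \<comment> \<open>A bound attained by the all-one vector, so competitors with a bound above
    \<open>C\<close> can be ignored.\<close>
  define C where "C = (\<Sum>i\<in>UNIV. tensor_apply m A ?one $ i + t $ i)"
  have C_ge: "tensor_apply m A ?one $ i + t $ i \<le> C" for i
    unfolding C_def by (rule member_le_sum) (use nonneg t in auto)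
  \<comment> \<open>\<open>undefined\<close> stands for an arbitrary index.\<close>
  have C: "0 \<le> C" using C_ge[of undefined] nonneg[of ?one undefined] t[of undefined] by simp
  obtain M where M: "\<And>x j. (\<And>i. 1 \<le> x $ i) \<Longrightarrow> (\<exists>i. x $ i = 1) \<Longrightarrow>
    (\<And>i. tensor_apply m A x $ i \<le> C * (x $ i) ^ (m - 1)) \<Longrightarrow> x $ j \<le> M"
    using sublevel_bounded[OF A C] by blast
  define M' where "M' = max M 1"
  \<comment> \<open>Pairing each vector with its bound turns the minimisation of a maximum of
    quotients into that of \<open>snd\<close> on a compact set.\<close>
  define T where "T = (cbox ?one (\<chi> i. M') \<times> {0..C}) \<inter> {p. \<forall>i. ?Q (fst p) (snd p) i}"
  have "closed {p. \<forall>i. ?Q (fst p) (snd p) i}"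
    by (intro closed_Collect_all closed_Collect_le continuous_intros continuous_on_tensor_apply)
  then have "compact T" unfolding T_def by (intro compact_Int_closed compact_Times) auto
  moreover have one: "(?one, C) \<in> T" using C C_ge by (auto simp: T_def mem_box_cart M'_def)
  moreover have "continuous_on T snd" by (intro continuous_intros)
  ultimately obtain z where z: "z \<in> T" "\<And>p. p \<in> T \<Longrightarrow> snd z \<le> snd p"
    using continuous_attains_inf[of T snd] by blast
  obtain x r where xr: "z = (x, r)" by (cases z)
  show thesis
  proof (rule that)
    show "0 < x $ i" for i
      using z(1) by (auto simp: xr T_def mem_box_cart intro: less_le_trans[of 0 1])
    show "?Q x r i" for i using z(1) by (auto simp: xr T_def)
    fix y s assume y: "\<And>i. 0 < y $ i" and Q: "\<And>i. ?Q y s i"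
    show "r \<le> s"
    proof (cases "s \<le> C")
      case False
      then show ?thesis using z(2)[OF one] by (simp add: xr)
    next
      case True
      define \<mu> where "\<mu> = Min (range (\<lambda>i. y $ i))"
      have \<mu>_le: "\<mu> \<le> y $ i" for i unfolding \<mu>_def by simp
      have "\<mu> \<in> range (\<lambda>i. y $ i)" unfolding \<mu>_def by (rule Min_in) auto
      then obtain i0 where i0: "y $ i0 = \<mu>" by auto
      have \<mu>: "0 < \<mu>" using y[of i0] i0 by simp
      define w where "w = (\<chi> i. (1 / \<mu>) * y $ i)"
      have w1: "1 \<le> w $ i" for i using \<mu>_le[of i] \<mu> by (simp add: w_def field_simps)
      have Qw: "?Q w s i" for i
      proof -
        have "(1 / \<mu>) ^ (m - 1) * (tensor_apply m A y $ i + t $ i * (y $ i) ^ (m - 1))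
          \<le> (1 / \<mu>) ^ (m - 1) * (s * (y $ i) ^ (m - 1))"
          using Q[of i] \<mu> by (intro mult_left_mono) auto
        then show ?thesis
          unfolding w_def tensor_apply_scale vec_lambda_beta power_mult_distrib
          by (simp only: distrib_left mult.left_commute mult.commute mult.assoc)
      qed
      have wpos: "0 < (w $ i) ^ (m - 1)" for i using w1[of i] by simp
      have "0 \<le> s"
      proof -
        have "0 \<le> s * (w $ i0) ^ (m - 1)"
          using Qw[of i0] nonneg[of w i0] t[of i0] w1 wpos[of i0]
          by (meson add_nonneg_nonneg less_imp_le less_le_trans mult_nonneg_nonneg order_trans zero_less_one)
        then show ?thesis using wpos[of i0] by (simp add: zero_le_mult_iff)
      qed
      have "w $ j \<le> M" for j
      proof (rule M)
        show "1 \<le> w $ i" for i by (rule w1)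
        show "\<exists>i. w $ i = 1" using i0 \<mu> by (intro exI[of _ i0]) (simp add: w_def)
        fix i
        have "s * (w $ i) ^ (m - 1) \<le> C * (w $ i) ^ (m - 1)"
          using True wpos[of i] by (intro mult_right_mono) auto
        moreover have "0 \<le> t $ i * (w $ i) ^ (m - 1)" using t[of i] wpos[of i] by simp
        ultimately show "tensor_apply m A w $ i \<le> C * (w $ i) ^ (m - 1)"
          using Qw[of i] by linarith
      qed
      then have "(w, s) \<in> T"
        using w1 Qw True \<open>0 \<le> s\<close> by (auto simp: T_def mem_box_cart M'_def le_max_iff_disj)
      then show ?thesis using z(2) by (force simp: xr)
    qed
  qed
qed

text \<open>
  Among the vectors attaining the least bound on the Collatz-Wielandt quotients, take one with as many strict inequalities as possible;
  shrinking its strict coordinates slightly would produce a further strict inequality.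
\<close>

lemma positive_eigenvector:
  fixes A :: "(real, 'n::finite) tensor" and t :: "real ^ 'n"
  assumes A: "nonneg_tensor m A" "m \<ge> 2" "weakly_irreducible m A" and t: "\<And>i. 0 \<le> t $ i"
  obtains x r where "\<And>i. 0 < x $ i"
    and "\<And>i. tensor_apply m A x $ i + t $ i * (x $ i) ^ (m - 1) = r * (x $ i) ^ (m - 1)"
proof -
  let ?L = "\<lambda>x i. tensor_apply m A x $ i + t $ i * (x $ i) ^ (m - 1)"
  obtain x0 r where x0: "\<And>i. 0 < x0 $ i" "\<And>i. ?L x0 i \<le> r * (x0 $ i) ^ (m - 1)"
    and r: "\<And>y s. (\<And>i. 0 < y $ i) \<Longrightarrow> (\<And>i. ?L y i \<le> s * (y $ i) ^ (m - 1)) \<Longrightarrow> r \<le> s"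
    using minimal_superharmonic[OF A t] by blast
  define P where "P x \<longleftrightarrow> (\<forall>i. 0 < x $ i) \<and> (\<forall>i. ?L x i \<le> r * (x $ i) ^ (m - 1))" for x
  define I where "I x = {i. ?L x i < r * (x $ i) ^ (m - 1)}" for x
  have "\<exists>x. P x \<and> (\<forall>y. P y \<longrightarrow> card (I y) \<le> card (I x))"
    by (rule ex_has_greatest_nat[of P x0 _ "Suc CARD('n)"])
      (use x0 in \<open>auto simp: P_def less_Suc_eq_le intro: card_mono\<close>)
  then obtain x where x: "P x" and max: "\<And>y. P y \<Longrightarrow> card (I y) \<le> card (I x)" by blast
  have pos: "0 < x $ i" for i using x by (simp add: P_def)
  have le: "?L x i \<le> r * (x $ i) ^ (m - 1)" for i using x by (simp add: P_def)
  \<comment> \<open>If every inequality were strict, the largest quotient of \<open>x\<close> would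
    be a bound smaller than \<open>r\<close>.\<close>
  have "I x \<noteq> UNIV"
  proof
    assume "I x = UNIV"
    let ?q = "\<lambda>i. ?L x i / (x $ i) ^ (m - 1)"
    have lt: "?q i < r" for i
      using \<open>I x = UNIV\<close> pos[of i] by (auto simp: I_def divide_less_eq)
    have "r \<le> Max (range ?q)"
    proof (rule r[OF pos])
      fix i
      have "?q i \<le> Max (range ?q)" by (rule Max_ge) auto
      then show "?L x i \<le> Max (range ?q) * (x $ i) ^ (m - 1)"
        using pos[of i] by (simp add: divide_le_eq)
    qed
    moreover have "Max (range ?q) < r" using lt by (subst Max_less_iff) (auto simp del: Max_less_iff)
    ultimately show False using leD by blast
  qed
  moreover have "I x = UNIV" if nonempty: "I x \<noteq> {}"
  proof (rule ccontr)
    assume "I x \<noteq> UNIV"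
    have "- I x \<noteq> {}" "- I x \<noteq> UNIV" using nonempty \<open>I x \<noteq> UNIV\<close> by auto
    \<comment> \<open>The complement of \<open>I x\<close> is not closed, so some tight row
      \<open>i\<close> depends on a strict index \<open>j\<close>; shrinking \<open>x $ j\<close>
      will make row \<open>i\<close> strict.\<close>
    then obtain i j where ij: "i \<notin> I x" "j \<in> tensor_nbrs m A i" "j \<in> I x"
      using weakly_irreducible_closed[OF A(3), of "- I x"] by blast
    \<comment> \<open>The \<open>A\<close> part stays at \<open>x\<close> while the index's own
      coordinate is scaled. Strictness survives for \<open>s\<close> near 1 by continuity, and
      passing to \<open>y\<close> only lowers the \<open>A\<close> part.\<close>
    have "\<forall>\<^sub>F s in at_left 1. \<forall>i\<in>I x.
      tensor_apply m A x $ i + t $ i * (s * x $ i) ^ (m - 1) < r * (s * x $ i) ^ (m - 1)"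
    proof (intro eventually_ball_finite ballI)
      fix i assume "i \<in> I x"
      have lim: "((\<lambda>s. r * (s * x $ i) ^ (m - 1)
          - (tensor_apply m A x $ i + t $ i * (s * x $ i) ^ (m - 1))) \<longlongrightarrow>
        r * (1 * x $ i) ^ (m - 1) - (tensor_apply m A x $ i + t $ i * (1 * x $ i) ^ (m - 1))) (at_left 1)"
        by (intro tendsto_intros)
      have "\<forall>\<^sub>F s in at_left 1. 0 < r * (s * x $ i) ^ (m - 1)
          - (tensor_apply m A x $ i + t $ i * (s * x $ i) ^ (m - 1))"
        by (rule order_tendstoD(1)[OF lim]) (use \<open>i \<in> I x\<close> in \<open>simp add: I_def\<close>)
      then show "\<forall>\<^sub>F s in at_left 1.
        tensor_apply m A x $ i + t $ i * (s * x $ i) ^ (m - 1) < r * (s * x $ i) ^ (m - 1)"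
        by eventually_elim simp
    qed simp
    moreover have "\<forall>\<^sub>F s in at_left (1::real). 0 < s \<and> s < 1"
      using eventually_at_left_real[of 0 "1::real"] by simp
    ultimately have "\<forall>\<^sub>F s in at_left (1::real). 0 < s \<and> s < 1 \<and> (\<forall>i\<in>I x.
      tensor_apply m A x $ i + t $ i * (s * x $ i) ^ (m - 1) < r * (s * x $ i) ^ (m - 1))"
      by eventually_elim auto
    then obtain s where s: "0 < s" "s < 1" and sI: "\<And>i. i \<in> I x \<Longrightarrow>
      tensor_apply m A x $ i + t $ i * (s * x $ i) ^ (m - 1) < r * (s * x $ i) ^ (m - 1)"
      using eventually_happens trivial_limit_at_left_real by blast
    define y where "y = (\<chi> i. if i \<in> I x then s * x $ i else x $ i)"
    have y: "0 < y $ k" "y $ k \<le> x $ k" for k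
      using pos[of k] s by (auto simp: y_def mult_le_cancel_right1)
    have Ay: "tensor_apply m A y $ k \<le> tensor_apply m A x $ k" for k
      by (rule tensor_apply_mono[OF A(1,2)]) (use y in auto)
    have strict: "?L y k < r * (y $ k) ^ (m - 1)" if "k \<in> I x" for k
      using sI[OF that] Ay[of k] that by (simp add: y_def)
    have weak: "?L y k \<le> r * (y $ k) ^ (m - 1)" if "k \<notin> I x" for k
      using le[of k] Ay[of k] that by (simp add: y_def)
    have "tensor_apply m A y $ i \<noteq> tensor_apply m A x $ i"
    proof
      assume "tensor_apply m A y $ i = tensor_apply m A x $ i"
      then have "y $ j = x $ j"
        using ij(2) y by (intro tensor_apply_mono(2)[OF A(1,2), of i y x]) auto
      then show False using ij(3) s pos[of j] by (simp add: y_def)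
    qed
    then have "i \<in> I y" using le[of i] Ay[of i] ij(1) by (simp add: I_def y_def)
    moreover have "I x \<subseteq> I y" using strict by (auto simp: I_def)
    ultimately have "I x \<subset> I y" using ij(1) by blast
    then have "card (I x) < card (I y)" by (intro psubset_card_mono) auto
    moreover have "P y"
      unfolding P_def using y strict weak by (metis less_imp_le)
    ultimately show False using max by fastforce
  qed
  ultimately have "i \<notin> I x" for i by blast
  then have "?L x i = r * (x $ i) ^ (m - 1)" for i
    using le[of i] by (simp add: I_def not_less order_antisym)
  then show thesis using that pos by blast
qed

section \<open>Bounds on the spectral radius and the cases of equality\<close>

text \<open>Applied to the positive eigenvector found above and, under condition (i), to
  \<open>R\<close> itself.\<close>

lemma spectral_radius_add_diag:
  fixes A :: "(real, 'n::finite) tensor"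
  assumes A: "nonneg_tensor m A" "m \<ge> 2" and t: "\<And>i. 0 \<le> t $ i"
    and x: "\<And>i. 0 < x $ i" and "0 \<le> r"
    and "\<And>i. tensor_apply m A x $ i + t $ i * (x $ i) ^ (m - 1) = r * (x $ i) ^ (m - 1)"
  shows "tensor_spectral_radius m (\<lambda>js. complex_of_real (A js + diag_tensor m t js)) = r"
proof (rule tensor_spectral_radius_eq)
  show "nonneg_tensor m (\<lambda>js. A js + diag_tensor m t js)"
    using A(1) t by (simp add: nonneg_tensor_def diag_tensor_def)
qed (use assms in \<open>auto simp: tensor_apply_add_diag\<close>)

theorem theorem2p3:
  fixes m :: nat
    and A B :: "(real, 'n::finite) tensor"
    and R S t :: "real ^ 'n"
    and F :: "'n \<Rightarrow> 'n \<Rightarrow> real"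
    and \<rho> lo hi :: real
  assumes "CARD('n) \<ge> 2"
    and "m \<ge> 2"
    and "nonneg_tensor m A"
    and "weakly_irreducible m A"
    and "\<And>i. A (replicate m i) = 0"
    and "\<And>i. R $ i > 0"
    and "S = tensor_apply m A R"
    and "\<And>i. t $ i \<ge> 0"
    and "B = (\<lambda>js. A js + diag_tensor m t js)"
    and "\<And>i j. F i j =
           (t $ i + t $ j
             + sqrt ((t $ i - t $ j)\<^sup>2 + 4 * S $ i * S $ j / (R $ i * R $ j) ^ (m - 1))) / 2"
    and "\<rho> = tensor_spectral_radius m (\<lambda>js. complex_of_real (B js))"
    and "lo = Min {F i j | i j. j \<in> tensor_nbrs m A i}"
    and "hi = Max {F i j | i j. j \<in> tensor_nbrs m A i}"
  shows "lo \<le> \<rho> \<and> \<rho> \<le> hi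
    \<and> (lo = \<rho> \<or> \<rho> = hi \<longleftrightarrow>
         (\<forall>i j. t $ i + S $ i / (R $ i) ^ (m - 1) = t $ j + S $ j / (R $ j) ^ (m - 1))
       \<or> (\<exists>U W. tensor_bipartition m A U W \<and>
            (\<exists>l>0. \<forall>i\<in>U. \<forall>j\<in>W.
               \<rho> = t $ i + l ^ (m - 1) * S $ i / (R $ i) ^ (m - 1) \<and>
               \<rho> = t $ j + S $ j / (l ^ (m - 1) * (R $ j) ^ (m - 1)))))
    \<and> (lo = \<rho> \<longrightarrow>
         (\<forall>i j. t $ i + S $ i / (R $ i) ^ (m - 1) = t $ j + S $ j / (R $ j) ^ (m - 1))
       \<or> (\<exists>U W. tensor_bipartition m A U W \<and>
            (\<exists>l>1. \<forall>i\<in>U. \<forall>j\<in>W.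
               \<rho> = t $ i + l ^ (m - 1) * S $ i / (R $ i) ^ (m - 1) \<and>
               \<rho> = t $ j + S $ j / (l ^ (m - 1) * (R $ j) ^ (m - 1)))))
    \<and> (\<rho> = hi \<longrightarrow>
         (\<forall>i j. t $ i + S $ i / (R $ i) ^ (m - 1) = t $ j + S $ j / (R $ j) ^ (m - 1))
       \<or> (\<exists>U W. tensor_bipartition m A U W \<and>
            (\<exists>l>0. l < 1 \<and> (\<forall>i\<in>U. \<forall>j\<in>W.
               \<rho> = t $ i + l ^ (m - 1) * S $ i / (R $ i) ^ (m - 1) \<and>
               \<rho> = t $ j + S $ j / (l ^ (m - 1) * (R $ j) ^ (m - 1))))))"
proof -
  note card2 = assms(1) and m2 = assms(2) and irr = assms(4) and R = assms(6)
    and S = assms(7) and t = assms(8) and F = assms(10)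
  have A: "nonneg_tensor m A" "m \<ge> 2" by fact+
  define k where "k = m - 1"
  have k: "0 < k" using m2 by (simp add: k_def)
  define N where "N = tensor_nbrs m A"
  define s where "s i = S $ i / (R $ i) ^ k" for i
  have N: "N i \<noteq> {}" for i
    unfolding N_def by (rule weakly_irreducible_nbrs_nonempty[OF irr card2])
  have closed: "\<forall>V. V \<noteq> {} \<and> (\<forall>i\<in>V. N i \<subseteq> V) \<longrightarrow> V = UNIV"
    using weakly_irreducible_closed[OF irr] unfolding N_def by blast
  have S_pos: "0 < S $ i" for i
    unfolding S using N[unfolded N_def] R by (intro tensor_apply_pos[OF A]) auto
  have s: "0 < s i" for i using S_pos[of i] R[of i] by (simp add: s_def)
  have Fs: "F i j = (t $ i + t $ j + sqrt ((t $ i - t $ j)\<^sup>2 + 4 * (s i * s j))) / 2" for i j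
    by (simp add: F s_def k_def power_mult_distrib)
  obtain x r where x: "\<And>i. 0 < x $ i"
    and ev: "\<And>i. tensor_apply m A x $ i + t $ i * (x $ i) ^ (m - 1) = r * (x $ i) ^ (m - 1)"
    using positive_eigenvector[OF A irr t] by blast
  have ev': "tensor_apply m A x $ i = (r - t $ i) * (x $ i) ^ k" for i
    using ev[of i] by (simp add: k_def algebra_simps)
  have r_gt: "t $ i < r" for i
  proof -
    have "0 < (r - t $ i) * (x $ i) ^ k"
      unfolding ev'[symmetric] using N[unfolded N_def] x by (intro tensor_apply_pos[OF A]) auto
    then show ?thesis using x[of i] by (simp add: zero_less_mult_iff)
  qed
  have r0: "0 \<le> r" using r_gt[of undefined] t[of undefined] by simp
  have \<rho>: "\<rho> = r"
    using spectral_radius_add_diag[OF A t x r0 ev] assms(9,11) by simp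
  have \<rho>_gt: "t $ i < \<rho>" for i using r_gt \<rho> by simp
  define u where "u i = (\<rho> - t $ i) / s i" for i
  have u: "0 < u i" for i using \<rho>_gt[of i] s[of i] by (simp add: u_def)
  have \<rho>_u: "\<rho> = t $ i + u i * s i" for i using s[of i] by (simp add: u_def)
  have F_le: "F i j \<le> \<rho> \<longleftrightarrow> 1 \<le> u i * u j" and F_ge: "\<rho> \<le> F i j \<longleftrightarrow> u i * u j \<le> 1" for i j
    unfolding Fs using quadratic_root_le_iff[of "s i * s j" "t $ i" \<rho> "t $ j"] s[of i] s[of j]
      \<rho>_gt[of i] \<rho>_gt[of j] by (auto simp: u_def less_imp_le)
  define y where "y i = x $ i / R $ i" for i
  have y: "0 < y i" for i using x[of i] R[of i] by (simp add: y_def)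
  have xy: "x $ i = y i * R $ i" for i using R[of i] by (simp add: y_def)
  define Y where "Y i = y i ^ k" for i
  have Y: "0 < Y i" for i using y[of i] by (simp add: Y_def)
  have Y_le: "Y i \<le> Y j \<longleftrightarrow> y i \<le> y j" and Y_eq: "Y i = Y j \<longleftrightarrow> y i = y j" for i j
    unfolding Y_def using y[of i] y[of j] k by (simp_all add: power_mono_iff power_eq_iff_eq_base)
  have Ax: "tensor_apply m A x $ i = u i * Y i * S $ i" for i
    using s[of i] R[of i] S_pos[of i] unfolding ev' u_def Y_def s_def \<rho>[symmetric]
    by (simp add: xy power_mult_distrib)
  \<comment> \<open>The multiple of \<open>R\<close> that agrees with \<open>x\<close> at
    \<open>p\<close> has a known image. Comparing it with \<open>x\<close> in row \<open>i\<close>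
    yields the mean property, from above in \<open>mean\<close> and from below in
    \<open>mean'\<close>.\<close>
  have Az: "tensor_apply m A (\<chi> j. y p * R $ j) $ i = Y p * S $ i" for p i
    unfolding tensor_apply_scale S Y_def k_def ..
  have mean: "u i * Y i \<le> Y p"
    "u i * Y i = Y p \<Longrightarrow> j \<in> N i \<Longrightarrow> Y j = Y p"
    if le: "\<And>j. j \<in> N i \<Longrightarrow> Y j \<le> Y p" for i p j
  proof -
    let ?z = "\<chi> j. y p * R $ j"
    have *: "0 < x $ j \<and> x $ j \<le> (\<chi> j. y p * R $ j) $ j" if "j \<in> tensor_nbrs m A i" for j
      using le[of j] that x[of j] R[of j] by (simp add: N_def xy[of j] Y_le)
    show "u i * Y i \<le> Y p"
      using tensor_apply_mono(1)[OF A, of i x ?z, OF *] S_pos[of i] unfolding Ax Az by simp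
    assume "u i * Y i = Y p" "j \<in> N i"
    then have "x $ j = (\<chi> j. y p * R $ j) $ j"
      using tensor_apply_mono(2)[OF A, of i x ?z j, OF *] unfolding Ax Az N_def by simp
    then show "Y j = Y p" using R[of j] by (simp add: xy[of j] Y_eq)
  qed
  have mean': "Y p \<le> u i * Y i"
    "u i * Y i = Y p \<Longrightarrow> j \<in> N i \<Longrightarrow> Y j = Y p"
    if ge: "\<And>j. j \<in> N i \<Longrightarrow> Y p \<le> Y j" for i p j
  proof -
    let ?z = "\<chi> j. y p * R $ j"
    have *: "0 < (\<chi> j. y p * R $ j) $ j \<and> (\<chi> j. y p * R $ j) $ j \<le> x $ j"
      if "j \<in> tensor_nbrs m A i" for j
      using ge[of j] that y[of p] R[of j] by (simp add: N_def xy[of j] Y_le)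
    show "Y p \<le> u i * Y i"
      using tensor_apply_mono(1)[OF A, of i ?z x, OF *] S_pos[of i] unfolding Ax Az by simp
    assume "u i * Y i = Y p" "j \<in> N i"
    then have "(\<chi> j. y p * R $ j) $ j = x $ j"
      using tensor_apply_mono(2)[OF A, of i ?z x j, OF *] unfolding Ax Az N_def by simp
    then show "Y j = Y p" using R[of j] by (simp add: xy[of j] Y_eq)
  qed
  have "\<forall>i p. (\<forall>j\<in>N i. Y j \<le> Y p) \<longrightarrow>
      u i * Y i \<le> Y p \<and> (u i * Y i = Y p \<longrightarrow> (\<forall>j\<in>N i. Y j = Y p))"
    using mean by blast
  note upper = extremal_weights[OF u Y N closed this]
  \<comment> \<open>The lower bound is the upper bound for the reciprocal data.\<close>
  have inv_pos: "0 < 1 / u i" "0 < 1 / Y i" for i using u Y by simp_all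
  have "\<forall>i p. (\<forall>j\<in>N i. 1 / Y j \<le> 1 / Y p) \<longrightarrow>
      1 / u i * (1 / Y i) \<le> 1 / Y p \<and>
      (1 / u i * (1 / Y i) = 1 / Y p \<longrightarrow> (\<forall>j\<in>N i. 1 / Y j = 1 / Y p))"
  proof (intro allI impI)
    fix i p assume le: "\<forall>j\<in>N i. 1 / Y j \<le> 1 / Y p"
    have ge: "Y p \<le> Y j" if "j \<in> N i" for j
      using bspec[OF le that] Y[of p] Y[of j] by (simp add: field_simps)
    have inv: "1 / u i * (1 / Y i) = 1 / (u i * Y i)" by simp
    have "1 / (u i * Y i) \<le> 1 / Y p"
      using mean'(1)[OF ge] Y[of p] by (intro divide_left_mono) (auto intro: mult_pos_pos u Y)
    moreover have "\<forall>j\<in>N i. 1 / Y j = 1 / Y p" if "1 / (u i * Y i) = 1 / Y p"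
      using mean'(2)[OF ge] that by (metis divide_inverse inverse_eq_iff_eq mult_1)
    ultimately show "1 / u i * (1 / Y i) \<le> 1 / Y p \<and>
      (1 / u i * (1 / Y i) = 1 / Y p \<longrightarrow> (\<forall>j\<in>N i. 1 / Y j = 1 / Y p))"
      unfolding inv by blast
  qed
  note lower = extremal_weights[OF inv_pos N closed this]

  define \<F> where "\<F> = {F i j | i j. j \<in> N i}"
  have "\<F> = (\<lambda>(i, j). F i j) ` {(i, j). j \<in> N i}" unfolding \<F>_def by auto
  then have fin: "finite \<F>" by simp
  have ne: "\<F> \<noteq> {}" using N unfolding \<F>_def by blast
  have lo: "lo = Min \<F>" and hi: "hi = Max \<F>" using assms(12,13) by (simp_all add: \<F>_def N_def)
  have lo_le: "lo \<le> F i j" and le_hi: "F i j \<le> hi" if "j \<in> N i" for i j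
    using that fin unfolding lo hi \<F>_def by (auto intro!: Min_le Max_ge)
  have "lo \<le> \<rho>"
  proof -
    obtain p q where "q \<in> N p" "1 / u p * (1 / u q) \<le> 1" using lower(1) by blast
    then have "F p q \<le> \<rho>" using u[of p] u[of q] by (simp add: F_le field_simps)
    then show ?thesis using lo_le[OF \<open>q \<in> N p\<close>] by simp
  qed
  have "\<rho> \<le> hi"
  proof -
    obtain p q where "q \<in> N p" "u p * u q \<le> 1" using upper(1) by blast
    then have "\<rho> \<le> F p q" by (simp add: F_ge)
    then show ?thesis using le_hi[OF \<open>q \<in> N p\<close>] by simp
  qed

  let ?c1 = "\<forall>i j. t $ i + S $ i / (R $ i) ^ (m - 1) = t $ j + S $ j / (R $ j) ^ (m - 1)"
  let ?c2 = "\<lambda>U W l. \<forall>i\<in>U. \<forall>j\<in>W.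
               \<rho> = t $ i + l ^ (m - 1) * S $ i / (R $ i) ^ (m - 1) \<and>
               \<rho> = t $ j + S $ j / (l ^ (m - 1) * (R $ j) ^ (m - 1))"
  have c1_iff: "?c1 \<longleftrightarrow> (\<forall>i j. t $ i + s i = t $ j + s j)" by (simp add: s_def k_def)
  \<comment> \<open>In terms of the weights, condition (3) says that \<open>u\<close> is
    \<open>l ^ k\<close> on \<open>U\<close> and \<open>1 / l ^ k\<close> on
    \<open>W\<close>.\<close>
  have c2_iff: "?c2 U W l \<longleftrightarrow> (\<forall>i\<in>U. \<forall>j\<in>W. u i = l ^ k \<and> u j = 1 / l ^ k)" if "0 < l" for U W l
  proof -
    have "\<rho> = t $ i + l ^ (m - 1) * S $ i / (R $ i) ^ (m - 1) \<longleftrightarrow> u i = l ^ k" for i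
      unfolding k_def[symmetric] times_divide_eq_right[symmetric] s_def[symmetric]
      using \<rho>_u[of i] s[of i] by simp
    moreover have "\<rho> = t $ j + S $ j / (l ^ (m - 1) * (R $ j) ^ (m - 1)) \<longleftrightarrow> u j = 1 / l ^ k" for j
    proof -
      have "S $ j / (l ^ (m - 1) * (R $ j) ^ (m - 1)) = 1 / l ^ k * s j"
        by (simp add: s_def k_def)
      then show ?thesis using \<rho>_u[of j] s[of j] by (metis add_left_cancel mult_right_cancel less_irrefl)
    qed
    ultimately show ?thesis by blast
  qed
  have bip: "tensor_bipartition m A U W"
    if "U \<union> W = UNIV" "U \<inter> W = {}" "\<forall>i\<in>U. N i \<subseteq> W" "\<forall>i\<in>W. N i \<subseteq> U" for U W
  proof -
    have "set js \<subseteq> N i" if "length js = m - 1" "A (i # js) \<noteq> 0" for i js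
      using that unfolding N_def tensor_nbrs_def by blast
    then show ?thesis
      unfolding tensor_bipartition_def using that by (metis UNIV_I UnE order_trans)
  qed
  have bipD: "(i \<in> U \<and> j \<in> W) \<or> (i \<in> W \<and> j \<in> U)"
    if "tensor_bipartition m A U W" "j \<in> N i" for U W i j
    using that unfolding tensor_bipartition_def N_def tensor_nbrs_def by blast
  have all_one: ?c1 if "\<forall>i. u i = 1"
    unfolding c1_iff using that \<rho>_u by (metis mult_1)

  have hi_imp: "?c1 \<or> (\<exists>U W. tensor_bipartition m A U W \<and> (\<exists>l>0. l < 1 \<and> ?c2 U W l))" if "\<rho> = hi"
  proof -
    have "\<forall>i. \<forall>j\<in>N i. 1 \<le> u i * u j"
      using le_hi F_le unfolding \<open>\<rho> = hi\<close>[symmetric] by blast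
    from upper(2)[OF this] consider "\<forall>i. u i = 1"
      | U W c where "U \<union> W = UNIV" "U \<inter> W = {}" "0 < c" "c < 1"
         "\<forall>i\<in>U. u i = c \<and> N i \<subseteq> W" "\<forall>i\<in>W. u i = 1 / c \<and> N i \<subseteq> U"
      by blast
    then show ?thesis
    proof cases
      case 1
      then show ?thesis using all_one by blast
    next
      \<comment> \<open>The number \<open>l\<close> is the \<open>k\<close>-th root of the weight on
        \<open>U\<close>, hence below 1 together with \<open>c\<close>.\<close>
      case (2 U W c)
      have l: "0 < root k c" "root k c < 1" "root k c ^ k = c" using 2 k by auto
      have "?c2 U W (root k c)" unfolding c2_iff[OF l(1)] l(3) using 2 by auto
      moreover have "tensor_bipartition m A U W" using 2 by (intro bip) auto
      ultimately show ?thesis using l by blast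
    qed
  qed
  have lo_imp: "?c1 \<or> (\<exists>U W. tensor_bipartition m A U W \<and> (\<exists>l>1. ?c2 U W l))" if "lo = \<rho>"
  proof -
    have "1 \<le> 1 / u i * (1 / u j)" if "j \<in> N i" for i j
      using lo_le[OF that] \<open>lo = \<rho>\<close> F_ge[of i j] u[of i] u[of j] by (simp add: field_simps)
    then have "\<forall>i. \<forall>j\<in>N i. 1 \<le> 1 / u i * (1 / u j)" by blast
    from lower(2)[OF this] consider "\<forall>i. 1 / u i = 1"
      | U W c where "U \<union> W = UNIV" "U \<inter> W = {}" "0 < c" "c < 1"
         "\<forall>i\<in>U. 1 / u i = c \<and> N i \<subseteq> W" "\<forall>i\<in>W. 1 / u i = 1 / c \<and> N i \<subseteq> U"
      by blast
    then show ?thesis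
    proof cases
      case 1
      then show ?thesis using all_one by simp
    next
      case (2 U W c)
      \<comment> \<open>For the reciprocal data \<open>c\<close> is \<open>1 / u i\<close> on
        \<open>U\<close>, so the weight there is \<open>1 / c\<close> and its root exceeds
        1.\<close>
      have l: "1 < root k (1 / c)" "root k (1 / c) ^ k = 1 / c" using 2 k by auto
      have l0: "0 < root k (1 / c)" using l(1) by linarith
      have uc: "u i = 1 / c" if "1 / u i = c" for i using that u[of i] by auto
      have "?c2 U W (root k (1 / c))" unfolding c2_iff[OF l0] l(2) using 2 uc by auto
      moreover have "tensor_bipartition m A U W" using 2 by (intro bip) auto
      ultimately show ?thesis using l by blast
    qed
  qed
  \<comment> \<open>If the weights multiply to 1 along every edge, no \<open>F i j\<close> in
    \<open>\<F>\<close> lies below \<open>\<rho>\<close>, so neither does the minimum.\<close>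
  have all_eq: "lo = \<rho>" if "\<And>i j. j \<in> N i \<Longrightarrow> u i * u j = 1"
  proof -
    have "\<rho> \<le> v" if "v \<in> \<F>" for v
      using that \<open>\<And>i j. j \<in> N i \<Longrightarrow> u i * u j = 1\<close> F_ge by (auto simp: \<F>_def)
    then have "\<rho> \<le> lo" unfolding lo using fin ne by simp
    then show ?thesis using \<open>lo \<le> \<rho>\<close> by simp
  qed
  have c1_imp: "lo = \<rho>" if ?c1
  proof -
    \<comment> \<open>Under condition (i) the vector \<open>R\<close> is a positive eigenvector with
      eigenvalue the common value \<open>c\<close>; thus \<open>\<rho> = c\<close> and all weights
      are 1.\<close>
    define c where "c = t $ undefined + s undefined"
    have c: "t $ i + s i = c" for i using that unfolding c1_iff c_def by blast
    have "tensor_apply m A R $ i + t $ i * (R $ i) ^ (m - 1) = c * (R $ i) ^ (m - 1)" for i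
      using c[of i] R[of i] by (simp add: S s_def k_def field_simps flip: c)
    moreover have "0 \<le> c" using c[of undefined] t[of undefined] s[of undefined] by simp
    ultimately have "\<rho> = c"
      using spectral_radius_add_diag[OF A t R, of c] assms(9,11) by simp
    then have "u i = 1" for i using c[of i] s[of i] by (simp add: u_def field_simps)
    then show ?thesis by (intro all_eq) simp
  qed
  have c2_imp: "lo = \<rho>" if "tensor_bipartition m A U W" "0 < l" "?c2 U W l" for U W l
  proof (rule all_eq)
    fix i j assume "j \<in> N i"
    \<comment> \<open>An edge has one end in \<open>U\<close> and the other in \<open>W\<close>, so
      the joint quantification over both sets can be instantiated.\<close>
    then show "u i * u j = 1"
      using bipD[OF that(1)] that(3)[unfolded c2_iff[OF that(2)]] \<open>0 < l\<close> by fastforce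
  qed
  have "lo = \<rho> \<or> \<rho> = hi \<longleftrightarrow> ?c1 \<or> (\<exists>U W. tensor_bipartition m A U W \<and> (\<exists>l>0. ?c2 U W l))"
  proof
    assume "lo = \<rho> \<or> \<rho> = hi"
    then show "?c1 \<or> (\<exists>U W. tensor_bipartition m A U W \<and> (\<exists>l>0. ?c2 U W l))"
      using lo_imp hi_imp less_trans[OF zero_less_one] by blast
  next
    assume "?c1 \<or> (\<exists>U W. tensor_bipartition m A U W \<and> (\<exists>l>0. ?c2 U W l))"
    then show "lo = \<rho> \<or> \<rho> = hi" using c1_imp c2_imp by blast
  qed
  then show ?thesis
    using \<open>lo \<le> \<rho>\<close> \<open>\<rho> \<le> hi\<close> lo_imp hi_imp by (intro conjI impI)
qed

end
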